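(* Let $(\boldsymbol\phi,\boldsymbol\psi)$ and $(\widetilde{\boldsymbol\phi},\widetilde{\boldsymbol\psi})$ be two elements of $\mathcal A_C$ that both maximize $J_\epsilon$ over $\mathcal A_C$. Then there are real constants $a_1,\dots,a_p$ satisfying $\sum_{i=1}^p\lambda_ia_i=0$ such that $$\widetilde\phi_i=\phi_i-a_i,\qquad\widetilde\psi_i=\psi_i+a_i,\qquad i=1,\dots,p.$$
   Context: Setting. Let $p\ge 2$ and $\epsilon>0$. Let $X_1,\dots,X_p$ and $Y$ be compact metric spaces; $\mathcal P(Z)$ denotes the Borel probability measures on $Z$ and $C(Z)$ the real-valued continuous functions on $Z$. For each $i$, let $\nu_i\in\mathcal P(X_i)$, $c_i\in C(X_i\times Y)$, and $\lambda_i>0$ with $\sum_{i=1}^p\lambda_i=1$. Fix $\eta\in\mathcal P(Y)$. Standing assumption: $\operatorname{spt}\nu_i=X_i$ for all $i$ and $\operatorname{spt}\eta=Y$. Set $\xi_i:=\nu_i\otimes\eta$ (product measure). $\mathcal A_C$ is the set of pairs $(\boldsymbol\phi,\boldsymbol\psi)$ with $\boldsymbol\phi=(\phi_1,\dots,\phi_p)$, $\boldsymbol\psi=(\psi_1,\dots,\psi_p)$, $\phi_i\in C(X_i)$, $\psi_i\in C(Y)$ and $\sum_{i=1}^p\lambda_i\psi_i=0$ on $Y$. The dual functional is $$J_\epsilon(\boldsymbol\phi,\boldsymbol\psi):=\sum_{i=1}^p\lambda_i\left[\int_{X_i}\phi_i\,d\nu_i-\epsilon\int_{X_i\times Y}\exp\left(\frac{\phi_i(x)+\psi_i(y)-c_i(x,y)}{\epsilon}\right)d\xi_i(x,y)\right].$$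 *)

theory Defs
  imports "HOL-Probability.Probability"
begin

text \<open>
  The spaces \<open>X\<^sub>1, \<dots>, X\<^sub>p\<close> and \<open>Y\<close> are elements of the library type of metric spaces with explicit
  carrier and distance, so that each \<open>X\<^sub>i\<close> has its own carrier and its own metric. Functions on them
  are total HOL functions of which only the values on the carrier matter. The weights \<open>\<lambda>\<^sub>i\<close> are called
  \<open>lam i\<close>.
\<close>

definition borel_of_metric :: "'a metric \<Rightarrow> 'a measure" where
  "borel_of_metric Z = sigma (mspace Z) {U. openin (mtopology_of Z) U}"

definition borel_prob_measures :: "'a metric \<Rightarrow> 'a measure set" where
  "borel_prob_measures Z = {\<mu>. prob_space \<mu> \<and> sets \<mu> = sets (borel_of_metric Z)}"

definition spt :: "'a metric \<Rightarrow> 'a measure \<Rightarrow> 'a set" where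
  "spt Z \<mu> = {x \<in> mspace Z. \<forall>U. openin (mtopology_of Z) U \<and> x \<in> U \<longrightarrow> 0 < emeasure \<mu> U}"

definition admissible_C ::
  "nat \<Rightarrow> (nat \<Rightarrow> real) \<Rightarrow> (nat \<Rightarrow> 'a metric) \<Rightarrow> 'b metric
    \<Rightarrow> ((nat \<Rightarrow> 'a \<Rightarrow> real) \<times> (nat \<Rightarrow> 'b \<Rightarrow> real)) set" where
  "admissible_C p lam X Y = {(\<phi>, \<psi>).
     (\<forall>i\<in>{1..p}. continuous_map (mtopology_of (X i)) euclideanreal (\<phi> i)) \<and>
     (\<forall>i\<in>{1..p}. continuous_map (mtopology_of Y) euclideanreal (\<psi> i)) \<and>
     (\<forall>y\<in>mspace Y. (\<Sum>i=1..p. lam i * \<psi> i y) = 0)}"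

definition dual_functional ::
  "nat \<Rightarrow> real \<Rightarrow> (nat \<Rightarrow> real) \<Rightarrow> (nat \<Rightarrow> 'a measure) \<Rightarrow> 'b measure \<Rightarrow> (nat \<Rightarrow> 'a \<times> 'b \<Rightarrow> real)
    \<Rightarrow> (nat \<Rightarrow> 'a \<Rightarrow> real) \<times> (nat \<Rightarrow> 'b \<Rightarrow> real) \<Rightarrow> real" where
  "dual_functional p \<epsilon> lam \<nu> \<eta> c = (\<lambda>(\<phi>, \<psi>).
     \<Sum>i=1..p. lam i *
       ((LINT x|\<nu> i. \<phi> i x)
        - \<epsilon> * (LINT (x, y)|(\<nu> i \<Otimes>\<^sub>M \<eta>). exp ((\<phi> i x + \<psi> i y - c i (x, y)) / \<epsilon>))))"

end

theory Submission
  imports Defs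
begin

text \<open>
  Write \<open>u\<close>, \<open>v\<close> for the two exponents \<open>(\<phi>\<^sub>i + \<psi>\<^sub>i - c\<^sub>i) / \<epsilon>\<close>. The midpoint of two maximizers is
  admissible, so it cannot beat them; but passing to the midpoint raises the functional by a
  positive combination of the integrals of \<open>(exp (u / 2) - exp (v / 2))\<^sup>2\<close>. Hence \<open>u = v\<close> almost
  everywhere, and by continuity and full support everywhere, so that
  \<open>\<phi>\<^sub>i x - \<phi>'\<^sub>i x = \<psi>'\<^sub>i y - \<psi>\<^sub>i y\<close> depends neither on \<open>x\<close> nor on \<open>y\<close>.
\<close>

text \<open>Each point of \<open>K\<close> has an open box around it inside \<open>W\<close>, and
  compactness leaves finitely many of these boxes. Finiteness is what makes the union measurable for
  a product sigma-algebra, where an arbitrary union of boxes may fail to be.\<close>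

lemma compactin_prod_topology_box_cover:
  assumes K: "compactin (prod_topology S T) K" and W: "openin (prod_topology S T) W" and "K \<subseteq> W"
  obtains F where "finite F" "F \<subseteq> {(U, V). openin S U \<and> openin T V}"
    "K \<subseteq> (\<Union>(U, V)\<in>F. U \<times> V)" "(\<Union>(U, V)\<in>F. U \<times> V) \<subseteq> W"
proof -
  define \<U> where "\<U> = {(U, V). openin S U \<and> openin T V \<and> U \<times> V \<subseteq> W}"
  have "\<exists>\<F>. finite \<F> \<and> \<F> \<subseteq> (\<lambda>(U, V). U \<times> V) ` \<U> \<and> K \<subseteq> \<Union>\<F>"
  proof (rule compactinD[OF K])
    show "openin (prod_topology S T) B" if "B \<in> (\<lambda>(U, V). U \<times> V) ` \<U>" for B
      using that by (auto simp: \<U>_def openin_prod_Times_iff)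
    show "K \<subseteq> \<Union>((\<lambda>(U, V). U \<times> V) ` \<U>)"
    proof
      fix z assume "z \<in> K"
      then have "(fst z, snd z) \<in> W" using \<open>K \<subseteq> W\<close> by auto
      then obtain U V where "openin S U" "openin T V" "fst z \<in> U" "snd z \<in> V" "U \<times> V \<subseteq> W"
        using W unfolding openin_prod_topology_alt by meson
      then show "z \<in> \<Union>((\<lambda>(U, V). U \<times> V) ` \<U>)"
        by (intro UnionI[of "U \<times> V"] image_eqI[of _ _ "(U, V)"]) (simp_all add: \<U>_def mem_Times_iff)
    qed
  qed
  then obtain \<F> where \<F>: "finite \<F>" "\<F> \<subseteq> (\<lambda>(U, V). U \<times> V) ` \<U>" "K \<subseteq> \<Union>\<F>" by blast
  then obtain F where F: "F \<subseteq> \<U>" "finite F" "\<F> = (\<lambda>(U, V). U \<times> V) ` F"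
    by (meson finite_subset_image)
  show thesis
  proof (rule that[of F])
    show "F \<subseteq> {(U, V). openin S U \<and> openin T V}" "(\<Union>(U, V)\<in>F. U \<times> V) \<subseteq> W"
      using F(1) by (auto simp: \<U>_def)
    show "K \<subseteq> (\<Union>(U, V)\<in>F. U \<times> V)" using \<F>(3) F(3) by simp
  qed (rule F(2))
qed

text \<open>
  The measure carries the product of the two Borel sigma-algebras, which may be smaller than the
  Borel sigma-algebra of the product; compactness makes \<open>{a < f}\<close> a countable union of open boxes.
\<close>

lemma borel_measurable_continuous_map_prod_topology:
  fixes f :: "'a \<times> 'b \<Rightarrow> real"
  assumes S: "compact_space S" "space M = topspace S" "\<And>U. openin S U \<Longrightarrow> U \<in> sets M"
    and T: "compact_space T" "space N = topspace T" "\<And>V. openin T V \<Longrightarrow> V \<in> sets N"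
    and f: "continuous_map (prod_topology S T) euclideanreal f"
  shows "f \<in> borel_measurable (M \<Otimes>\<^sub>M N)"
proof (rule borel_measurableI_greater)
  fix a :: real
  let ?Z = "topspace S \<times> topspace T"
  define W where "W = {z \<in> ?Z. a < f z}"
  \<comment> \<open>\<open>W\<close> itself is open and in general not compact. It is exhausted by
    closed superlevel sets, which are compact because the product is; each of them can be separated
    from the complement of \<open>W\<close> by a finite union of boxes.\<close>
  define K where "K n = {z \<in> ?Z. a + inverse (real (Suc n)) \<le> f z}" for n
  have W: "openin (prod_topology S T) W"
    using openin_continuous_map_preimage[OF f, of "{a<..}"] by (simp add: W_def)
  have "\<exists>B \<in> sets (M \<Otimes>\<^sub>M N). K n \<subseteq> B \<and> B \<subseteq> W" for n
  proof -
    have "closedin (prod_topology S T) (K n)"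
      using closedin_continuous_map_preimage[OF f, of "{a + inverse (real (Suc n))..}"]
      by (simp add: K_def)
    then have K: "compactin (prod_topology S T) (K n)"
      using S(1) T(1) by (simp add: closedin_compact_space compact_space_prod_topology)
    have "K n \<subseteq> W"
    proof
      fix z assume "z \<in> K n"
      then have "z \<in> ?Z" "a + inverse (real (Suc n)) \<le> f z" by (simp_all add: K_def)
      moreover have "0 < inverse (real (Suc n))" by simp
      ultimately have "a < f z" by linarith
      with \<open>z \<in> ?Z\<close> show "z \<in> W" by (simp add: W_def)
    qed
    from compactin_prod_topology_box_cover[OF K W this] obtain F
      where F: "finite F" "F \<subseteq> {(U, V). openin S U \<and> openin T V}"
        "K n \<subseteq> (\<Union>(U, V)\<in>F. U \<times> V)" "(\<Union>(U, V)\<in>F. U \<times> V) \<subseteq> W" .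
    have "(\<Union>(U, V)\<in>F. U \<times> V) \<in> sets (M \<Otimes>\<^sub>M N)"
      using F(1,2) S(3) T(3) by (intro sets.finite_UN) auto
    then show ?thesis using F(3,4) by (intro bexI conjI)
  qed
  then obtain B where B: "\<And>n. B n \<in> sets (M \<Otimes>\<^sub>M N)" "\<And>n. K n \<subseteq> B n" "\<And>n. B n \<subseteq> W"
    by metis
  have "W \<subseteq> (\<Union>n. K n)"
  proof
    fix z assume z: "z \<in> W"
    then have "0 < f z - a" by (simp add: W_def)
    then obtain n where "inverse (real (Suc n)) < f z - a" using reals_Archimedean by blast
    then have "a + inverse (real (Suc n)) \<le> f z" by linarith
    then have "z \<in> K n" using z unfolding K_def W_def by blast
    then show "z \<in> (\<Union>n. K n)" by blast
  qed
  also have "\<dots> \<subseteq> (\<Union>n. B n)" using B(2) by (rule UN_mono[OF subset_refl])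
  finally have "W = (\<Union>n. B n)" using B(3) by (intro equalityI UN_least)
  then have "W \<in> sets (M \<Otimes>\<^sub>M N)" using B(1) by auto
  then show "{z \<in> space (M \<Otimes>\<^sub>M N). a < f z} \<in> sets (M \<Otimes>\<^sub>M N)"
    by (simp add: W_def space_pair_measure S(2) T(2))
qed

lemma borel_measurable_continuous_map:
  fixes f :: "'a \<Rightarrow> real"
  assumes "space M = topspace S" "\<And>U. openin S U \<Longrightarrow> U \<in> sets M"
    and f: "continuous_map S euclideanreal f"
  shows "f \<in> borel_measurable M"
proof (rule borel_measurableI_greater)
  fix a
  show "{x \<in> space M. a < f x} \<in> sets M"
    using assms(1,2) openin_continuous_map_preimage[OF f, of "{a<..}"] by simp
qed

text \<open>Compactness bounds \<open>f\<close>, and bounded measurable functions are integrable for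
  a finite measure. Measurability is assumed separately so that the lemma serves both for a single
  space and for a product carrying the product sigma-algebra.\<close>

lemma (in finite_measure) integrable_continuous_map_compact_space:
  fixes f :: "'a \<Rightarrow> real"
  assumes "compact_space S" "space M = topspace S" "continuous_map S euclideanreal f"
    and "f \<in> borel_measurable M"
  shows "integrable M f"
proof -
  have "compactin euclideanreal (f ` topspace S)"
    using assms(1,3) image_compactin unfolding compact_space_def by blast
  then have "bounded (f ` topspace S)" by (simp add: compact_imp_bounded)
  then obtain B where "\<And>x. x \<in> topspace S \<Longrightarrow> norm (f x) \<le> B"
    unfolding bounded_iff by blast
  then show ?thesis
    using assms(2,4) by (intro integrable_const_bound[of _ B]) auto
qed

text \<open>If \<open>f\<close> and \<open>g\<close> differed at \<open>z\<close>, they would differ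
  on a whole open box around \<open>z\<close>. The measure of a box is the product of the measures
  of its sides, which are positive by full support of the factors, so the box cannot lie in a null
  set.\<close>

lemma continuous_map_AE_eq_imp_eq:
  fixes f g :: "'a \<times> 'b \<Rightarrow> real"
  assumes "sigma_finite_measure N"
    and S: "\<And>U. openin S U \<Longrightarrow> U \<in> sets M" "\<And>U. openin S U \<Longrightarrow> U \<noteq> {} \<Longrightarrow> 0 < emeasure M U"
    and T: "\<And>V. openin T V \<Longrightarrow> V \<in> sets N" "\<And>V. openin T V \<Longrightarrow> V \<noteq> {} \<Longrightarrow> 0 < emeasure N V"
    and f: "continuous_map (prod_topology S T) euclideanreal f"
    and g: "continuous_map (prod_topology S T) euclideanreal g"
    and AE: "AE z in M \<Otimes>\<^sub>M N. f z = g z"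
    and "z \<in> topspace S \<times> topspace T"
  shows "f z = g z"
proof (rule ccontr)
  interpret N: sigma_finite_measure N by fact
  assume "f z \<noteq> g z"
  let ?W = "{z \<in> topspace (prod_topology S T). f z - g z \<in> - {0}}"
  have "openin (prod_topology S T) ?W"
    by (rule openin_continuous_map_preimage) (auto intro!: continuous_map_diff f g)
  moreover have "(fst z, snd z) \<in> ?W" using assms(9) \<open>f z \<noteq> g z\<close> by auto
  ultimately obtain U V where UV: "openin S U" "openin T V" "fst z \<in> U" "snd z \<in> V" "U \<times> V \<subseteq> ?W"
    unfolding openin_prod_topology_alt by meson
  obtain Z where Z: "{z \<in> space (M \<Otimes>\<^sub>M N). f z \<noteq> g z} \<subseteq> Z"
      "emeasure (M \<Otimes>\<^sub>M N) Z = 0" "Z \<in> sets (M \<Otimes>\<^sub>M N)"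
    by (rule AE_E[OF AE])
  have sets: "U \<in> sets M" "V \<in> sets N" using UV S(1) T(1) by auto
  then have "U \<times> V \<subseteq> space (M \<Otimes>\<^sub>M N)" by (simp add: sets.sets_into_space)
  then have "U \<times> V \<subseteq> Z" using UV(5) Z(1) by auto
  then have "emeasure (M \<Otimes>\<^sub>M N) (U \<times> V) = 0"
    using emeasure_mono[OF _ Z(3)] Z(2) by fastforce
  then have "emeasure M U * emeasure N V = 0"
    using N.emeasure_pair_measure_Times[OF sets] by simp
  moreover have "0 < emeasure M U" using S(2)[OF UV(1)] UV(3) by auto
  moreover have "0 < emeasure N V" using T(2)[OF UV(2)] UV(4) by auto
  ultimately show False by auto
qed

text \<open>Strict convexity of \<open>exp\<close> in integrated form: the integrand of
  \<open>gap\<close> is a perfect square, since \<open>exp ((u z + v z) / 2)\<close> is the product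
  of the square roots of \<open>exp (u z)\<close> and \<open>exp (v z)\<close>.\<close>

lemma integral_exp_midpoint_gap:
  fixes u v :: "'a \<Rightarrow> real"
  assumes "integrable M (\<lambda>z. exp (u z))" "integrable M (\<lambda>z. exp (v z))"
    and "integrable M (\<lambda>z. exp ((u z + v z) / 2))"
  defines "gap \<equiv> (LINT z|M. exp (u z)) + (LINT z|M. exp (v z)) - 2 * (LINT z|M. exp ((u z + v z) / 2))"
  shows "0 \<le> gap" and "gap = 0 \<Longrightarrow> AE z in M. u z = v z"
proof -
  let ?h = "\<lambda>z. exp (u z) + exp (v z) - 2 * exp ((u z + v z) / 2)"
  have sq: "?h z = (exp (u z / 2) - exp (v z / 2))\<^sup>2" for z
  proof -
    have "exp (u z) = (exp (u z / 2))\<^sup>2" "exp (v z) = (exp (v z / 2))\<^sup>2"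
      by (simp_all flip: exp_double)
    moreover have "exp ((u z + v z) / 2) = exp (u z / 2) * exp (v z / 2)"
      by (simp add: add_divide_distrib exp_add)
    ultimately show ?thesis by (simp add: power2_diff)
  qed
  have int: "integrable M ?h" using assms(1-3) by simp
  have gap: "gap = (LINT z|M. ?h z)" unfolding gap_def using assms(1-3) by simp
  show "0 \<le> gap" unfolding gap by (simp add: sq)
  assume "gap = 0"
  then have "AE z in M. ?h z = 0"
    using integral_nonneg_eq_0_iff_AE[OF int] gap by (simp add: sq)
  then show "AE z in M. u z = v z" by (rule AE_mp) (simp add: sq)
qed

lemma borel_prob_measuresD:
  assumes "\<mu> \<in> borel_prob_measures Z"
  shows "prob_space \<mu>" "space \<mu> = topspace (mtopology_of Z)"
    and "\<And>U. openin (mtopology_of Z) U \<Longrightarrow> U \<in> sets \<mu>"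
proof -
  \<comment> \<open>The generators must lie in the carrier: otherwise \<open>sigma\<close> defaults
    to the trivial sigma-algebra.\<close>
  have sub: "{U. openin (mtopology_of Z) U} \<subseteq> Pow (mspace Z)"
    using openin_subset by fastforce
  have sets: "sets \<mu> = sets (borel_of_metric Z)"
    using assms by (simp add: borel_prob_measures_def)
  show "prob_space \<mu>" using assms by (simp add: borel_prob_measures_def)
  show "space \<mu> = topspace (mtopology_of Z)"
    using sets_eq_imp_space_eq[OF sets] sub by (simp add: borel_of_metric_def)
  show "U \<in> sets \<mu>" if "openin (mtopology_of Z) U" for U
    using sub that by (simp add: sets borel_of_metric_def)
qed

lemma emeasure_openin_pos:
  assumes "spt Z \<mu> = mspace Z" "openin (mtopology_of Z) U" "U \<noteq> {}"
  shows "0 < emeasure \<mu> U"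
proof -
  obtain x where "x \<in> U" using assms(3) by blast
  moreover have "x \<in> spt Z \<mu>"
    using openin_subset[OF assms(2)] \<open>x \<in> U\<close> assms(1) by auto
  ultimately show ?thesis using assms(2) by (auto simp: spt_def)
qed

lemma admissible_C_midpoint:
  assumes "(\<phi>, \<psi>) \<in> admissible_C p lam X Y" "(\<phi>', \<psi>') \<in> admissible_C p lam X Y"
  shows "(\<lambda>i x. (\<phi> i x + \<phi>' i x) / 2, \<lambda>i y. (\<psi> i y + \<psi>' i y) / 2) \<in> admissible_C p lam X Y"
proof -
  have "(\<Sum>i=1..p. lam i * ((\<psi> i y + \<psi>' i y) / 2)) = 0" if "y \<in> mspace Y" for y
  proof -
    have "(\<Sum>i=1..p. lam i * ((\<psi> i y + \<psi>' i y) / 2))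
        = ((\<Sum>i=1..p. lam i * \<psi> i y) + (\<Sum>i=1..p. lam i * \<psi>' i y)) / 2"
      by (simp add: sum.distrib[symmetric] sum_divide_distrib algebra_simps)
    then show ?thesis using assms that by (simp add: admissible_C_def)
  qed
  then show ?thesis
    using assms by (auto simp: admissible_C_def intro!: continuous_map_real_divide continuous_map_add)
qed

theorem corollary6p2:
  fixes p :: nat
    and \<epsilon> :: real
    and lam :: "nat \<Rightarrow> real"
    and X :: "nat \<Rightarrow> 'a metric"
    and Y :: "'b metric"
    and \<nu> :: "nat \<Rightarrow> 'a measure"
    and \<eta> :: "'b measure"
    and c :: "nat \<Rightarrow> 'a \<times> 'b \<Rightarrow> real"
    and \<phi> \<phi>' :: "nat \<Rightarrow> 'a \<Rightarrow> real"
    and \<psi> \<psi>' :: "nat \<Rightarrow> 'b \<Rightarrow> real"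
  assumes "2 \<le> p"
    and "0 < \<epsilon>"
    and "\<And>i. i \<in> {1..p} \<Longrightarrow> compact_space (mtopology_of (X i))"
    and "compact_space (mtopology_of Y)"
    and "\<And>i. i \<in> {1..p} \<Longrightarrow> \<nu> i \<in> borel_prob_measures (X i)"
    and "\<eta> \<in> borel_prob_measures Y"
    and "\<And>i. i \<in> {1..p} \<Longrightarrow> continuous_map (prod_topology (mtopology_of (X i)) (mtopology_of Y)) euclideanreal (c i)"
    and "\<And>i. i \<in> {1..p} \<Longrightarrow> 0 < lam i"
    and "(\<Sum>i=1..p. lam i) = 1"
    and "\<And>i. i \<in> {1..p} \<Longrightarrow> spt (X i) (\<nu> i) = mspace (X i)"
    and "spt Y \<eta> = mspace Y"
    and "is_arg_max (dual_functional p \<epsilon> lam \<nu> \<eta> c) (\<lambda>z. z \<in> admissible_C p lam X Y) (\<phi>, \<psi>)"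
    and "is_arg_max (dual_functional p \<epsilon> lam \<nu> \<eta> c) (\<lambda>z. z \<in> admissible_C p lam X Y) (\<phi>', \<psi>')"
  shows "\<exists>a :: nat \<Rightarrow> real. (\<Sum>i=1..p. lam i * a i) = 0 \<and>
    (\<forall>i\<in>{1..p}. (\<forall>x\<in>mspace (X i). \<phi>' i x = \<phi> i x - a i) \<and>
                 (\<forall>y\<in>mspace Y. \<psi>' i y = \<psi> i y + a i))"
proof -
  note \<epsilon> = assms(2) and X = assms(3) and Y = assms(4) and \<nu> = assms(5) and \<eta> = assms(6)
    and c = assms(7) and lam = assms(8)
  let ?J = "dual_functional p \<epsilon> lam \<nu> \<eta> c" and ?A = "admissible_C p lam X Y"
  define \<theta> \<zeta> where "\<theta> = (\<lambda>i x. (\<phi> i x + \<phi>' i x) / 2)" and "\<zeta> = (\<lambda>i y. (\<psi> i y + \<psi>' i y) / 2)"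
  define u v where "u = (\<lambda>i (x, y). (\<phi> i x + \<psi> i y - c i (x, y)) / \<epsilon>)"
    and "v = (\<lambda>i (x, y). (\<phi>' i x + \<psi>' i y - c i (x, y)) / \<epsilon>)"
  \<comment> \<open>Up to the factor \<open>\<epsilon> * lam i\<close>, this is the contribution of
    index \<open>i\<close> to twice the value at the midpoint minus the sum of the two maximal
    values.\<close>
  define gap where "gap i = (LINT z|(\<nu> i \<Otimes>\<^sub>M \<eta>). exp (u i z)) + (LINT z|(\<nu> i \<Otimes>\<^sub>M \<eta>). exp (v i z))
    - 2 * (LINT z|(\<nu> i \<Otimes>\<^sub>M \<eta>). exp ((u i z + v i z) / 2))" for i
  have adm: "(\<phi>, \<psi>) \<in> ?A" "(\<phi>', \<psi>') \<in> ?A"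
    using assms(12,13) by (simp_all add: is_arg_max_def)
  then have "(\<theta>, \<zeta>) \<in> ?A" unfolding \<theta>_def \<zeta>_def by (rule admissible_C_midpoint)
  then have J_mid: "2 * ?J (\<theta>, \<zeta>) \<le> ?J (\<phi>, \<psi>) + ?J (\<phi>', \<psi>')"
    using assms(12,13) unfolding is_arg_max_def by (smt (verit))
  note \<eta>D = borel_prob_measuresD[OF \<eta>]
  interpret \<eta>: prob_space \<eta> by (rule \<eta>D)

  have cont_\<phi>: "continuous_map (mtopology_of (X i)) euclideanreal (\<phi> i)"
      "continuous_map (mtopology_of (X i)) euclideanreal (\<phi>' i)"
    and cont_\<psi>: "continuous_map (mtopology_of Y) euclideanreal (\<psi> i)"
      "continuous_map (mtopology_of Y) euclideanreal (\<psi>' i)" if "i \<in> {1..p}" for i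
    using adm that by (auto simp: admissible_C_def)
  have cont_exponent: "continuous_map (prod_topology (mtopology_of (X i)) (mtopology_of Y))
      euclideanreal (\<lambda>(x, y). (f x + g y - c i (x, y)) / \<epsilon>)"
    if "i \<in> {1..p}" "continuous_map (mtopology_of (X i)) euclideanreal f"
      "continuous_map (mtopology_of Y) euclideanreal g" for i f g
  proof -
    have "continuous_map (prod_topology (mtopology_of (X i)) (mtopology_of Y)) euclideanreal (\<lambda>z. f (fst z))"
      "continuous_map (prod_topology (mtopology_of (X i)) (mtopology_of Y)) euclideanreal (\<lambda>z. g (snd z))"
      using continuous_map_compose[OF continuous_map_fst that(2)]
        continuous_map_compose[OF continuous_map_snd that(3)] by (simp_all add: o_def)
    then show ?thesis
      unfolding case_prod_unfold prod.collapse using \<epsilon> c[OF that(1)]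
      by (intro continuous_map_real_divide continuous_map_diff continuous_map_add) auto
  qed
  have cont_uv: "continuous_map (prod_topology (mtopology_of (X i)) (mtopology_of Y)) euclideanreal (u i)"
      "continuous_map (prod_topology (mtopology_of (X i)) (mtopology_of Y)) euclideanreal (v i)"
    if "i \<in> {1..p}" for i
    unfolding u_def v_def using that cont_\<phi> cont_\<psi> by (intro cont_exponent; simp)+

  \<comment> \<open>The exponent \<open>h\<close> is kept arbitrary because three of them occur:
    \<open>u i\<close>, \<open>v i\<close> and their average.\<close>
  have int_exp: "integrable (\<nu> i \<Otimes>\<^sub>M \<eta>) (\<lambda>z. exp (h z))"
    if i: "i \<in> {1..p}" and h: "continuous_map (prod_topology (mtopology_of (X i)) (mtopology_of Y)) euclideanreal h"
    for i h
  proof -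
    note \<nu>D = borel_prob_measuresD[OF \<nu>[OF i]]
    interpret \<nu>: prob_space "\<nu> i" by (rule \<nu>D)
    interpret pair_prob_space "\<nu> i" \<eta> ..
    have cont: "continuous_map (prod_topology (mtopology_of (X i)) (mtopology_of Y)) euclideanreal (\<lambda>z. exp (h z))"
      using continuous_map_compose[OF h, of euclideanreal exp] continuous_on_exp[OF continuous_on_id, of UNIV]
      by (simp add: o_def)
    show ?thesis
    proof (rule integrable_continuous_map_compact_space[OF _ _ cont])
      show "(\<lambda>z. exp (h z)) \<in> borel_measurable (\<nu> i \<Otimes>\<^sub>M \<eta>)"
        by (rule borel_measurable_continuous_map_prod_topology[OF X[OF i] \<nu>D(2,3) Y \<eta>D(2,3) cont])
    qed (use X[OF i] Y \<nu>D \<eta>D in \<open>simp_all add: compact_space_prod_topology space_pair_measure\<close>)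
  qed
  have int_uv: "integrable (\<nu> i \<Otimes>\<^sub>M \<eta>) (\<lambda>z. exp (u i z))" "integrable (\<nu> i \<Otimes>\<^sub>M \<eta>) (\<lambda>z. exp (v i z))"
      "integrable (\<nu> i \<Otimes>\<^sub>M \<eta>) (\<lambda>z. exp ((u i z + v i z) / 2))" if "i \<in> {1..p}" for i
    using that cont_uv[OF that] by (intro int_exp; auto intro!: continuous_map_real_divide continuous_map_add)+
  note gap_props = integral_exp_midpoint_gap[OF int_uv, folded gap_def]

  \<comment> \<open>The exponent is affine in the potentials, with the same cost on both sides, so
    the midpoint of the potentials yields the midpoint of the exponents.\<close>
  have mid_exponent: "(\<theta> i x + \<zeta> i y - c i (x, y)) / \<epsilon> = (u i (x, y) + v i (x, y)) / 2" for i x y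
    using \<epsilon> by (simp add: \<theta>_def \<zeta>_def u_def v_def field_simps)
  have "(LINT x|\<nu> i. \<theta> i x) = ((LINT x|\<nu> i. \<phi> i x) + (LINT x|\<nu> i. \<phi>' i x)) / 2"
    if i: "i \<in> {1..p}" for i
  proof -
    note \<nu>D = borel_prob_measuresD[OF \<nu>[OF i]]
    interpret \<nu>: prob_space "\<nu> i" by (rule \<nu>D)
    have "integrable (\<nu> i) (\<phi> i)" "integrable (\<nu> i) (\<phi>' i)"
      using cont_\<phi>[OF i] X[OF i] \<nu>D
      by (auto intro!: \<nu>.integrable_continuous_map_compact_space[where S = "mtopology_of (X i)"]
          borel_measurable_continuous_map[where S = "mtopology_of (X i)"])
    then show ?thesis by (simp add: \<theta>_def)
  qed
  \<comment> \<open>The integrals of the potentials cancel by linearity. The exponential integrals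
    enter the functional with the factor \<open>- \<epsilon>\<close>, so what remains is
    \<open>gap\<close> with a positive coefficient.\<close>
  then have "2 * ?J (\<theta>, \<zeta>) - ?J (\<phi>, \<psi>) - ?J (\<phi>', \<psi>') = (\<Sum>i=1..p. \<epsilon> * lam i * gap i)"
    unfolding dual_functional_def prod.case mid_exponent sum_distrib_left sum_subtractf[symmetric]
    by (intro sum.cong refl) (simp add: gap_def u_def v_def case_prod_unfold algebra_simps)
  then have "(\<Sum>i=1..p. \<epsilon> * lam i * gap i) \<le> 0" using J_mid by simp
  \<comment> \<open>Maximality makes the sum nonpositive while convexity makes every term
    nonnegative, so all terms vanish; \<open>\<epsilon>\<close> and \<open>lam i\<close> are
    positive and can be divided out.\<close>
  moreover have nonneg: "0 \<le> \<epsilon> * lam i * gap i" if "i \<in> {1..p}" for i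
    using that \<epsilon> lam[OF that] gap_props(1)[OF that that that] by simp
  ultimately have "(\<Sum>i=1..p. \<epsilon> * lam i * gap i) = 0" by (meson order_antisym sum_nonneg)
  then have "\<epsilon> * lam i * gap i = 0" if "i \<in> {1..p}" for i
    using that nonneg by (subst (asm) sum_nonneg_eq_0_iff) auto
  then have gap_0: "gap i = 0" if "i \<in> {1..p}" for i
    using that \<epsilon> lam[OF that] by fastforce

  \<comment> \<open>Full support turns almost everywhere equality of the exponents into equality at
    every point; the common cost and the factor \<open>1 / \<epsilon>\<close> then cancel.\<close>
  have eq: "\<phi> i x + \<psi> i y = \<phi>' i x + \<psi>' i y"
    if i: "i \<in> {1..p}" and xy: "x \<in> mspace (X i)" "y \<in> mspace Y" for i x y
  proof -
    note \<nu>D = borel_prob_measuresD[OF \<nu>[OF i]]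
    have "AE z in \<nu> i \<Otimes>\<^sub>M \<eta>. u i z = v i z" by (rule gap_props(2)[OF i i i gap_0[OF i]])
    then have "u i (x, y) = v i (x, y)"
      using xy \<nu>D(3) \<eta>D(3) emeasure_openin_pos[OF assms(10)[OF i]] emeasure_openin_pos[OF assms(11)]
      by (intro continuous_map_AE_eq_imp_eq[OF _ _ _ _ _ cont_uv[OF i]])
        (auto intro: \<eta>.sigma_finite_measure_axioms)
    then show ?thesis using \<epsilon> by (simp add: u_def v_def)
  qed
  \<comment> \<open>A probability space is nonempty, which supplies a base point. By
    \<open>eq\<close> the difference \<open>\<psi>' i y - \<psi> i y\<close> is the same for all
    \<open>y\<close>, so its value at \<open>y0\<close> serves as the constant; the weighted sum of
    these values vanishes because both tuples satisfy the constraint at \<open>y0\<close>.\<close>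
  obtain y0 where y0: "y0 \<in> mspace Y" using \<eta>.not_empty \<eta>D(2) by auto
  define a where "a i = \<psi>' i y0 - \<psi> i y0" for i
  have "(\<Sum>i=1..p. lam i * a i) = (\<Sum>i=1..p. lam i * \<psi>' i y0) - (\<Sum>i=1..p. lam i * \<psi> i y0)"
    by (simp add: a_def right_diff_distrib sum_subtractf)
  also have "\<dots> = 0" using adm y0 by (simp add: admissible_C_def)
  finally have "(\<Sum>i=1..p. lam i * a i) = 0" .
  moreover have \<phi>': "\<phi>' i x = \<phi> i x - a i" if "i \<in> {1..p}" "x \<in> mspace (X i)" for i x
    using eq[OF that y0] by (simp add: a_def)
  moreover have "\<psi>' i y = \<psi> i y + a i" if i: "i \<in> {1..p}" and y: "y \<in> mspace Y" for i y
  proof -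
    note \<nu>D = borel_prob_measuresD[OF \<nu>[OF i]]
    \<comment> \<open>Some point of \<open>X i\<close> is needed to carry the identity for
      \<open>\<phi>' i\<close> over to \<open>\<psi>' i\<close> through \<open>eq\<close>; it exists
      because \<open>\<nu> i\<close> is a probability measure.\<close>
    obtain x where x: "x \<in> mspace (X i)" using prob_space.not_empty[OF \<nu>D(1)] \<nu>D(2) by auto
    show ?thesis using eq[OF i x y] \<phi>'[OF i x] by simp
  qed
  ultimately show ?thesis by blast
qed

end
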